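(* For any $k,l\in\mathbb{N}\cup\{\infty\}$ with $k<l$, $Q_{\mathrm{cl}}(C^{k}(\mathbb{R}))\neq Q_{\mathrm{cl}}(C^{l}(\mathbb{R}))$. Moreover, for $k<l\le\infty$, $Q_{\mathrm{cl}}(C^{k}(\mathbb{R}))\supset Q_{\mathrm{cl}}(C^{l}(\mathbb{R}))$.
   Context: Here $\mathbb{N}=\{1,2,3,\dots\}$ and $k<\infty$ for all $k\in\mathbb{N}$. For $k\in\mathbb{N}$, $C^{k}(\mathbb{R})$ is the ring of functions $\mathbb{R}\to\mathbb{R}$ with continuous derivatives up to and including the $k$-th, and $C^{\infty}(\mathbb{R})=\bigcap_{k\in\mathbb{N}}C^{k}(\mathbb{R})$. For a commutative ring $R$, $Q_{\mathrm{cl}}(R)$ is the classical ring of quotients, i.e. the localization of $R$ at the set of all its non-zero divisors. A non-zero divisor of $C^{l}(\mathbb{R})$ (equivalently, an element whose cozero set $\{x\mid g(x)\ne 0\}$ is dense in $\mathbb{R}$) is also a non-zero divisor in $C^{k}(\mathbb{R})$ for $k<l$ and in the ring $C(\mathbb{R})$ of continuous real valued functions on $\mathbb{R}$. The inclusion and inequality are understood with respect to the resulting canonical embeddings $h/g\mapsto h/g$ of $Q_{\mathrm{cl}}(C^{l}(\mathbb{R}))$ into $Q_{\mathrm{cl}}(C^{k}(\mathbb{R}))$ (all of these rings being regarded as subrings of $Q_{\mathrm{cl}}(C(\mathbb{R}))$). *)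

theory Defs
  imports "HOL-Analysis.Analysis" "HOL-Algebra.Ring" "HOL-Real_Asymp.Real_Asymp"
begin

section \<open>Localization and the classical ring of quotients\<close>

text \<open>The fraction \<open>a/s\<close> is the equivalence class of the pair \<open>(a, s)\<close>. The factor \<open>u\<close> makes the
  relation transitive for an arbitrary multiplicative set \<open>S\<close>.\<close>

definition frac_rel :: "('a, 'm) ring_scheme \<Rightarrow> 'a set \<Rightarrow> (('a \<times> 'a) \<times> ('a \<times> 'a)) set" where
  "frac_rel R S = {((a, s), (b, t)). a \<in> carrier R \<and> s \<in> S \<and> b \<in> carrier R \<and> t \<in> S \<and>
     (\<exists>u\<in>S. u \<otimes>\<^bsub>R\<^esub> (t \<otimes>\<^bsub>R\<^esub> a) = u \<otimes>\<^bsub>R\<^esub> (s \<otimes>\<^bsub>R\<^esub> b))}"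

definition fraction :: "('a, 'm) ring_scheme \<Rightarrow> 'a set \<Rightarrow> 'a \<Rightarrow> 'a \<Rightarrow> ('a \<times> 'a) set" where
  "fraction R S a s = frac_rel R S `` {(a, s)}"

definition localization :: "('a, 'm) ring_scheme \<Rightarrow> 'a set \<Rightarrow> ('a \<times> 'a) set ring" where
  "localization R S =
    \<lparr>carrier = (carrier R \<times> S) // frac_rel R S,
     mult = (\<lambda>X Y. \<Union>(a, s)\<in>X. \<Union>(b, t)\<in>Y. fraction R S (a \<otimes>\<^bsub>R\<^esub> b) (s \<otimes>\<^bsub>R\<^esub> t)),
     one = fraction R S \<one>\<^bsub>R\<^esub> \<one>\<^bsub>R\<^esub>,
     zero = fraction R S \<zero>\<^bsub>R\<^esub> \<one>\<^bsub>R\<^esub>,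
     add = (\<lambda>X Y. \<Union>(a, s)\<in>X. \<Union>(b, t)\<in>Y.
              fraction R S (t \<otimes>\<^bsub>R\<^esub> a \<oplus>\<^bsub>R\<^esub> s \<otimes>\<^bsub>R\<^esub> b) (s \<otimes>\<^bsub>R\<^esub> t))\<rparr>"

definition non_zero_divisors :: "('a, 'm) ring_scheme \<Rightarrow> 'a set" where
  "non_zero_divisors R =
    {s \<in> carrier R. \<forall>a\<in>carrier R. s \<otimes>\<^bsub>R\<^esub> a = \<zero>\<^bsub>R\<^esub> \<longrightarrow> a = \<zero>\<^bsub>R\<^esub>}"

definition Qcl :: "('a, 'm) ring_scheme \<Rightarrow> ('a \<times> 'a) set ring" where
  "Qcl R = localization R (non_zero_divisors R)"

text \<open>The map \<open>h/g \<mapsto> h/g\<close> into \<open>Qcl R\<close> from the classical ring of quotients of a subring of \<open>R\<close>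
  each of whose non-zero divisors is a non-zero divisor of \<open>R\<close>.\<close>

definition Qcl_incl :: "('a, 'm) ring_scheme \<Rightarrow> ('a \<times> 'a) set \<Rightarrow> ('a \<times> 'a) set" where
  "Qcl_incl R X = (\<Union>(h, g)\<in>X. fraction R (non_zero_divisors R) h g)"

locale mult_set = cring R for R (structure) +
  fixes S
  assumes S_sub: "S \<subseteq> carrier R" and S_one: "\<one> \<in> S"
    and S_mult: "\<And>s t. s \<in> S \<Longrightarrow> t \<in> S \<Longrightarrow> s \<otimes> t \<in> S"
begin

lemma S_carr [simp]: "s \<in> S \<Longrightarrow> s \<in> carrier R"
  using S_sub by blast

lemma equiv_frac_rel: "equiv (carrier R \<times> S) (frac_rel R S)"
proof (rule equivI)
  show "frac_rel R S \<subseteq> (carrier R \<times> S) \<times> (carrier R \<times> S)"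
    by (auto simp: frac_rel_def)
  show "refl_on (carrier R \<times> S) (frac_rel R S)"
    using S_one by (auto simp: frac_rel_def refl_on_def)
  show "sym (frac_rel R S)"
    unfolding sym_def frac_rel_def by clarsimp metis
  show "trans (frac_rel R S)"
  proof (rule transI, clarify)
    fix a s b t c r
    assume "((a, s), b, t) \<in> frac_rel R S" "((b, t), c, r) \<in> frac_rel R S"
    then obtain u v where
      *: "a \<in> carrier R" "b \<in> carrier R" "c \<in> carrier R" "s \<in> S" "t \<in> S" "r \<in> S" "u \<in> S" "v \<in> S"
      and e1: "u \<otimes> (t \<otimes> a) = u \<otimes> (s \<otimes> b)" and e2: "v \<otimes> (r \<otimes> b) = v \<otimes> (t \<otimes> c)"
      by (auto simp: frac_rel_def)
    have "(u \<otimes> v \<otimes> t) \<otimes> (r \<otimes> a) = (v \<otimes> r) \<otimes> (u \<otimes> (t \<otimes> a))"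
      using * by (simp add: m_ac)
    also have "\<dots> = (u \<otimes> s) \<otimes> (v \<otimes> (r \<otimes> b))"
      unfolding e1 using * by (simp add: m_ac)
    also have "\<dots> = (u \<otimes> v \<otimes> t) \<otimes> (s \<otimes> c)"
      unfolding e2 using * by (simp add: m_ac)
    finally show "((a, s), c, r) \<in> frac_rel R S"
      using * S_mult unfolding frac_rel_def by blast
  qed
qed

lemma fraction_eq_iff:
  assumes "a \<in> carrier R" "s \<in> S" "b \<in> carrier R" "t \<in> S"
  shows "fraction R S a s = fraction R S b t \<longleftrightarrow> (\<exists>u\<in>S. u \<otimes> (t \<otimes> a) = u \<otimes> (s \<otimes> b))"
proof -
  have "fraction R S a s = fraction R S b t \<longleftrightarrow> ((a, s), (b, t)) \<in> frac_rel R S"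
    unfolding fraction_def using eq_equiv_class_iff[OF equiv_frac_rel] assms by simp
  then show ?thesis using assms by (simp add: frac_rel_def)
qed

lemma fraction_eqI:
  assumes "t \<otimes> a = s \<otimes> b" "a \<in> carrier R" "s \<in> S" "b \<in> carrier R" "t \<in> S"
  shows "fraction R S a s = fraction R S b t"
  using assms S_one by (auto simp: fraction_eq_iff)

lemma carrier_localization:
  "carrier (localization R S) = {fraction R S a s | a s. a \<in> carrier R \<and> s \<in> S}"
  by (auto simp: localization_def quotient_def fraction_def)

lemma fraction_in_carrier [simp]:
  "a \<in> carrier R \<Longrightarrow> s \<in> S \<Longrightarrow> fraction R S a s \<in> carrier (localization R S)"
  by (auto simp: carrier_localization)

lemma UN_fraction:
  assumes "\<And>b t c r. ((b, t), (c, r)) \<in> frac_rel R S \<Longrightarrow> f b t = f c r" "a \<in> carrier R" "s \<in> S"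
  shows "(\<Union>(b, t)\<in>fraction R S a s. f b t) = f a s"
proof -
  have "case_prod f respects frac_rel R S"
    using assms(1) by (auto simp: congruent_def)
  from UN_equiv_class[OF equiv_frac_rel this, of "(a, s)"] assms show ?thesis
    by (simp add: fraction_def)
qed

lemma mult_fraction:
  assumes "a \<in> carrier R" "s \<in> S" "b \<in> carrier R" "t \<in> S"
  shows "fraction R S a s \<otimes>\<^bsub>localization R S\<^esub> fraction R S b t = fraction R S (a \<otimes> b) (s \<otimes> t)"
proof -
  have 1: "(\<Union>(c, r)\<in>fraction R S b t. fraction R S (d \<otimes> c) (q \<otimes> r)) = fraction R S (d \<otimes> b) (q \<otimes> t)"
    if d: "d \<in> carrier R" "q \<in> S" for d q
  proof (rule UN_fraction)
    fix b t c r assume "((b, t), (c, r)) \<in> frac_rel R S"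
    then obtain u where *: "b \<in> carrier R" "t \<in> S" "c \<in> carrier R" "r \<in> S" "u \<in> S"
      and e: "u \<otimes> (r \<otimes> b) = u \<otimes> (t \<otimes> c)" by (auto simp: frac_rel_def)
    have "u \<otimes> ((q \<otimes> r) \<otimes> (d \<otimes> b)) = q \<otimes> d \<otimes> (u \<otimes> (r \<otimes> b))" using * d by (simp add: m_ac)
    also have "\<dots> = u \<otimes> ((q \<otimes> t) \<otimes> (d \<otimes> c))" unfolding e using * d by (simp add: m_ac)
    finally show "fraction R S (d \<otimes> b) (q \<otimes> t) = fraction R S (d \<otimes> c) (q \<otimes> r)"
      using * d S_mult by (subst fraction_eq_iff) auto
  qed (use assms in auto)
  have "(\<Union>(d, q)\<in>fraction R S a s. \<Union>(c, r)\<in>fraction R S b t. fraction R S (d \<otimes> c) (q \<otimes> r))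
      = (\<Union>(c, r)\<in>fraction R S b t. fraction R S (a \<otimes> c) (s \<otimes> r))"
  proof (rule UN_fraction)
    fix d q c r assume "((d, q), (c, r)) \<in> frac_rel R S"
    then obtain u where *: "d \<in> carrier R" "q \<in> S" "c \<in> carrier R" "r \<in> S" "u \<in> S"
      and e: "u \<otimes> (r \<otimes> d) = u \<otimes> (q \<otimes> c)" by (auto simp: frac_rel_def)
    have "u \<otimes> ((r \<otimes> t) \<otimes> (d \<otimes> b)) = t \<otimes> b \<otimes> (u \<otimes> (r \<otimes> d))" using * assms by (simp add: m_ac)
    also have "\<dots> = u \<otimes> ((q \<otimes> t) \<otimes> (c \<otimes> b))" unfolding e using * assms by (simp add: m_ac)
    finally have "fraction R S (d \<otimes> b) (q \<otimes> t) = fraction R S (c \<otimes> b) (r \<otimes> t)"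
      using * assms S_mult by (subst fraction_eq_iff) auto
    then show "(\<Union>(c, r)\<in>fraction R S b t. fraction R S (d \<otimes> c) (q \<otimes> r))
      = (\<Union>(c', r')\<in>fraction R S b t. fraction R S (c \<otimes> c') (r \<otimes> r'))"
      using * by (simp add: 1)
  qed (use assms in auto)
  then show ?thesis using assms by (simp add: 1 localization_def)
qed

lemma add_fraction:
  assumes "a \<in> carrier R" "s \<in> S" "b \<in> carrier R" "t \<in> S"
  shows "fraction R S a s \<oplus>\<^bsub>localization R S\<^esub> fraction R S b t = fraction R S (t \<otimes> a \<oplus> s \<otimes> b) (s \<otimes> t)"
proof -
  have 1: "(\<Union>(c, r)\<in>fraction R S b t. fraction R S (r \<otimes> d \<oplus> q \<otimes> c) (q \<otimes> r))
      = fraction R S (t \<otimes> d \<oplus> q \<otimes> b) (q \<otimes> t)"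
    if d: "d \<in> carrier R" "q \<in> S" for d q
  proof (rule UN_fraction)
    fix b t c r assume "((b, t), (c, r)) \<in> frac_rel R S"
    then obtain u where *: "b \<in> carrier R" "t \<in> S" "c \<in> carrier R" "r \<in> S" "u \<in> S"
      and e: "u \<otimes> (r \<otimes> b) = u \<otimes> (t \<otimes> c)" by (auto simp: frac_rel_def)
    have "u \<otimes> ((q \<otimes> r) \<otimes> (t \<otimes> d \<oplus> q \<otimes> b)) = u \<otimes> q \<otimes> r \<otimes> t \<otimes> d \<oplus> q \<otimes> q \<otimes> (u \<otimes> (r \<otimes> b))"
      using * d by (simp add: m_ac r_distr l_distr)
    also have "\<dots> = u \<otimes> ((q \<otimes> t) \<otimes> (r \<otimes> d \<oplus> q \<otimes> c))"
      unfolding e using * d by (simp add: m_ac r_distr l_distr)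
    finally show "fraction R S (t \<otimes> d \<oplus> q \<otimes> b) (q \<otimes> t) = fraction R S (r \<otimes> d \<oplus> q \<otimes> c) (q \<otimes> r)"
      using * d S_mult by (subst fraction_eq_iff) auto
  qed (use assms in auto)
  have "(\<Union>(d, q)\<in>fraction R S a s. \<Union>(c, r)\<in>fraction R S b t. fraction R S (r \<otimes> d \<oplus> q \<otimes> c) (q \<otimes> r))
      = (\<Union>(c, r)\<in>fraction R S b t. fraction R S (r \<otimes> a \<oplus> s \<otimes> c) (s \<otimes> r))"
  proof (rule UN_fraction)
    fix d q c r assume "((d, q), (c, r)) \<in> frac_rel R S"
    then obtain u where *: "d \<in> carrier R" "q \<in> S" "c \<in> carrier R" "r \<in> S" "u \<in> S"
      and e: "u \<otimes> (r \<otimes> d) = u \<otimes> (q \<otimes> c)" by (auto simp: frac_rel_def)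
    have "u \<otimes> ((r \<otimes> t) \<otimes> (t \<otimes> d \<oplus> q \<otimes> b)) = t \<otimes> t \<otimes> (u \<otimes> (r \<otimes> d)) \<oplus> u \<otimes> r \<otimes> t \<otimes> q \<otimes> b"
      using * assms by (simp add: m_ac r_distr l_distr)
    also have "\<dots> = u \<otimes> ((q \<otimes> t) \<otimes> (t \<otimes> c \<oplus> r \<otimes> b))"
      unfolding e using * assms by (simp add: m_ac r_distr l_distr)
    finally have "fraction R S (t \<otimes> d \<oplus> q \<otimes> b) (q \<otimes> t) = fraction R S (t \<otimes> c \<oplus> r \<otimes> b) (r \<otimes> t)"
      using * assms S_mult by (subst fraction_eq_iff) auto
    then show "(\<Union>(c, r)\<in>fraction R S b t. fraction R S (r \<otimes> d \<oplus> q \<otimes> c) (q \<otimes> r))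
      = (\<Union>(c', r')\<in>fraction R S b t. fraction R S (r' \<otimes> c \<oplus> r \<otimes> c') (r \<otimes> r'))"
      using * by (simp add: 1)
  qed (use assms in auto)
  then show ?thesis using assms by (simp add: 1 localization_def)
qed

lemma one_localization: "\<one>\<^bsub>localization R S\<^esub> = fraction R S \<one> \<one>"
  and zero_localization: "\<zero>\<^bsub>localization R S\<^esub> = fraction R S \<zero> \<one>"
  by (simp_all add: localization_def)

lemma cring_localization: "cring (localization R S)"
proof -
  let ?L = "localization R S"
  note [simp] = S_one S_mult mult_fraction add_fraction one_localization zero_localization
  note ac = m_ac a_ac r_distr l_distr r_minus l_neg r_neg
  have ex: "\<exists>a s. x = fraction R S a s \<and> a \<in> carrier R \<and> s \<in> S" if "x \<in> carrier ?L" for x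
    using that by (auto simp: carrier_localization)
  have ab: "abelian_group ?L"
  proof (rule abelian_groupI, goal_cases)
    case (1 x y)
    then show ?case using ex[of x] ex[of y] by clarsimp
  next
    case 2
    show ?case by simp
  next
    case (3 x y z)
    then show ?case using ex[of x] ex[of y] ex[of z]
      by (clarsimp simp: m_ac a_ac r_distr)
  next
    case (4 x y)
    then show ?case using ex[of x] ex[of y]
      by (clarsimp simp: m_ac a_ac r_distr)
  next
    case (5 x)
    then show ?case using ex[of x]
      by clarsimp
  next
    case (6 x)
    then obtain a s where x: "x = fraction R S a s" "a \<in> carrier R" "s \<in> S" using ex by blast
    show ?case
    proof
      show "fraction R S (\<ominus> a) s \<in> carrier ?L" using x by simp
      show "fraction R S (\<ominus> a) s \<oplus>\<^bsub>?L\<^esub> x = \<zero>\<^bsub>?L\<^esub>"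
        using x by simp (rule fraction_eqI; simp add: ac)
    qed
  qed
  have cm: "Group.comm_monoid ?L"
  proof (rule comm_monoidI, goal_cases)
    case (1 x y)
    then show ?case using ex[of x] ex[of y] by clarsimp
  next
    case 2
    show ?case by simp
  next
    case (3 x y z)
    then show ?case using ex[of x] ex[of y] ex[of z] by (auto simp: m_assoc)
  next
    case (4 x)
    then show ?case using ex[of x]
      by clarsimp
  next
    case (5 x y)
    then show ?case using ex[of x] ex[of y] by (auto simp: m_comm)
  qed
  show ?thesis
  proof (rule cringI[OF ab cm])
    fix x y z assume "x \<in> carrier ?L" "y \<in> carrier ?L" "z \<in> carrier ?L"
    from ex[OF this(1)] ex[OF this(2)] ex[OF this(3)] obtain a s b t c r
      where [simp]: "x = fraction R S a s" "y = fraction R S b t" "z = fraction R S c r"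
        "a \<in> carrier R" "s \<in> S" "b \<in> carrier R" "t \<in> S" "c \<in> carrier R" "r \<in> S"
      by (elim exE conjE)
    let ?n = "(t \<otimes> a \<oplus> s \<otimes> b) \<otimes> c"
    let ?m = "(t \<otimes> r) \<otimes> (a \<otimes> c) \<oplus> (s \<otimes> r) \<otimes> (b \<otimes> c)"
    have m: "?m = r \<otimes> ?n" by (simp add: r_distr l_distr m_ac)
    have "fraction R S ?n (s \<otimes> t \<otimes> r) = fraction R S ?m (s \<otimes> r \<otimes> (t \<otimes> r))"
      unfolding m by (rule fraction_eqI) (simp_all add: m_ac)
    then show "(x \<oplus>\<^bsub>?L\<^esub> y) \<otimes>\<^bsub>?L\<^esub> z = x \<otimes>\<^bsub>?L\<^esub> z \<oplus>\<^bsub>?L\<^esub> y \<otimes>\<^bsub>?L\<^esub> z"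
      by simp
  qed
qed

end

lemma (in cring) mult_set_non_zero_divisors: "mult_set R (non_zero_divisors R)"
proof (rule mult_set.intro[OF is_cring mult_set_axioms.intro])
  show "non_zero_divisors R \<subseteq> carrier R"
    by (auto simp: non_zero_divisors_def)
  show "\<one> \<in> non_zero_divisors R"
    by (simp add: non_zero_divisors_def)
  fix s t assume s: "s \<in> non_zero_divisors R" and t: "t \<in> non_zero_divisors R"
  have c: "s \<in> carrier R" "t \<in> carrier R"
    using s t unfolding non_zero_divisors_def by blast+
  have "a = \<zero>" if "a \<in> carrier R" "s \<otimes> t \<otimes> a = \<zero>" for a
  proof -
    have "s \<otimes> (t \<otimes> a) = \<zero>" using that c by (simp add: m_assoc)
    then have "t \<otimes> a = \<zero>"
      using s c m_closed[OF c(2) that(1)] unfolding non_zero_divisors_def by blast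
    then show ?thesis using t that(1) unfolding non_zero_divisors_def by blast
  qed
  then show "s \<otimes> t \<in> non_zero_divisors R"
    using c by (auto simp: non_zero_divisors_def)
qed

theorem (in cring) cring_Qcl: "cring (Qcl R)"
  unfolding Qcl_def by (rule mult_set.cring_localization[OF mult_set_non_zero_divisors])

section \<open>The rings \<open>C\<^sup>k(\<real>)\<close>\<close>

definition fun_ring :: "(real \<Rightarrow> real) set \<Rightarrow> (real \<Rightarrow> real) ring" where
  "fun_ring A =
    \<lparr>carrier = A, mult = (\<lambda>f g x. f x * g x), one = (\<lambda>x. 1), zero = (\<lambda>x. 0),
     add = (\<lambda>f g x. f x + g x)\<rparr>"

text \<open>\<^const>\<open>deriv\<close> is total: \<open>(deriv ^^ Suc i) f\<close> is the derivative of \<open>(deriv ^^ i) f\<close> only where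
  the latter is differentiable.\<close>

definition C_nat :: "nat \<Rightarrow> (real \<Rightarrow> real) set" where
  "C_nat n = {f. (\<forall>i<n. \<forall>x. ((deriv ^^ i) f) field_differentiable (at x)) \<and>
                 (\<forall>i\<le>n. continuous_on UNIV ((deriv ^^ i) f))}"

definition C_diff :: "enat \<Rightarrow> (real \<Rightarrow> real) set" where
  "C_diff k = (case k of enat n \<Rightarrow> C_nat n | \<infinity> \<Rightarrow> (\<Inter>n\<in>{1..}. C_nat n))"

abbreviation C_ring :: "enat \<Rightarrow> (real \<Rightarrow> real) ring" where
  "C_ring k \<equiv> fun_ring (C_diff k)"

abbreviation cont_ring :: "(real \<Rightarrow> real) ring" where
  "cont_ring \<equiv> fun_ring {f. continuous_on UNIV f}"

text \<open>\<open>Q\<^sub>c\<^sub>l(C\<^sup>k(\<real>))\<close> regarded as a subring of \<open>Q\<^sub>c\<^sub>l(C(\<real>))\<close>; that the map is an injective ring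
  homomorphism is shown in \<open>Qcl_incl_hom\<close> and \<open>Qcl_incl_inj\<close> below.\<close>

definition Qcl_C :: "enat \<Rightarrow> ((real \<Rightarrow> real) \<times> (real \<Rightarrow> real)) set set" where
  "Qcl_C k = Qcl_incl cont_ring ` carrier (Qcl (C_ring k))"

lemma fun_ring_simps [simp]:
  "carrier (fun_ring A) = A" "f \<otimes>\<^bsub>fun_ring A\<^esub> g = (\<lambda>x. f x * g x)"
  "f \<oplus>\<^bsub>fun_ring A\<^esub> g = (\<lambda>x. f x + g x)"
  "\<one>\<^bsub>fun_ring A\<^esub> = (\<lambda>x. 1)" "\<zero>\<^bsub>fun_ring A\<^esub> = (\<lambda>x. 0)"
  by (simp_all add: fun_ring_def)

lemma cring_fun_ring:
  assumes const: "\<And>c. (\<lambda>x. c) \<in> A"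
    and add: "\<And>f g. f \<in> A \<Longrightarrow> g \<in> A \<Longrightarrow> (\<lambda>x. f x + g x) \<in> A"
    and mult: "\<And>f g. f \<in> A \<Longrightarrow> g \<in> A \<Longrightarrow> (\<lambda>x. f x * g x) \<in> A"
  shows "cring (fun_ring A)"
proof (rule cringI)
  show "abelian_group (fun_ring A)"
  proof (rule abelian_groupI)
    fix f assume "f \<in> carrier (fun_ring A)"
    then have "(\<lambda>x. - f x) \<in> A"
      using mult[OF const[of "-1"], of f] by simp
    then show "\<exists>g\<in>carrier (fun_ring A). g \<oplus>\<^bsub>fun_ring A\<^esub> f = \<zero>\<^bsub>fun_ring A\<^esub>"
      by (intro bexI[of _ "\<lambda>x. - f x"]) auto
  qed (auto simp: add const algebra_simps)
  show "Group.comm_monoid (fun_ring A)"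
    by (rule comm_monoidI) (auto simp: mult const algebra_simps)
qed (auto simp: algebra_simps)

lemma C_nat_0: "C_nat 0 = {f. continuous_on UNIV f}"
  by (simp add: C_nat_def)

lemma field_differentiable_imp_continuous_on:
  "(\<And>x. f field_differentiable (at x)) \<Longrightarrow> continuous_on UNIV (f :: real \<Rightarrow> real)"
  by (simp add: continuous_at_imp_continuous_on field_differentiable_imp_continuous_at)

lemma C_nat_Suc:
  "f \<in> C_nat (Suc n) \<longleftrightarrow> (\<forall>x. f field_differentiable (at x)) \<and> deriv f \<in> C_nat n"
proof -
  have eq: "(deriv ^^ Suc i) f = (deriv ^^ i) (deriv f)" for i
    by (simp add: funpow_swap1)
  show ?thesis
    using field_differentiable_imp_continuous_on[of f]
    unfolding C_nat_def less_Suc_eq_le[symmetric] All_less_Suc2 mem_Collect_eq eq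
    by (auto simp: All_less_Suc2)
qed

lemma C_nat_antimono: "m \<le> n \<Longrightarrow> C_nat n \<subseteq> C_nat m"
  by (auto simp: C_nat_def)

lemma C_nat_const: "(\<lambda>x. c) \<in> C_nat n"
proof (induction n arbitrary: c)
  case (Suc n)
  have "deriv (\<lambda>x::real. c) = (\<lambda>x. 0)" by (rule ext) simp
  then show ?case using Suc by (simp add: C_nat_Suc)
qed (simp add: C_nat_0)

lemma C_nat_add: "f \<in> C_nat n \<Longrightarrow> g \<in> C_nat n \<Longrightarrow> (\<lambda>x. f x + g x) \<in> C_nat n"
proof (induction n arbitrary: f g)
  case (Suc n)
  then have "deriv (\<lambda>x. f x + g x) = (\<lambda>x. deriv f x + deriv g x)"
    by (intro ext) (simp add: C_nat_Suc)
  then show ?case using Suc by (auto simp: C_nat_Suc intro: field_differentiable_add)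
qed (auto simp: C_nat_0 intro: continuous_intros)

lemma C_nat_mult: "f \<in> C_nat n \<Longrightarrow> g \<in> C_nat n \<Longrightarrow> (\<lambda>x. f x * g x) \<in> C_nat n"
proof (induction n arbitrary: f g)
  case (Suc n)
  then have "deriv (\<lambda>x. f x * g x) = (\<lambda>x. f x * deriv g x + deriv f x * g x)"
    by (intro ext) (simp add: C_nat_Suc)
  moreover have "f \<in> C_nat n" "g \<in> C_nat n"
    using Suc.prems C_nat_antimono[of n "Suc n"] by auto
  ultimately show ?case
    using Suc by (auto simp: C_nat_Suc intro!: field_differentiable_mult C_nat_add)
qed (auto simp: C_nat_0 intro: continuous_intros)

lemma C_diff_simps: "C_diff (enat n) = C_nat n" "C_diff \<infinity> = (\<Inter>n. C_nat n)"
proof -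
  have "C_nat 1 \<subseteq> C_nat 0" by (rule C_nat_antimono) simp
  then have "(\<Inter>n\<in>{1..}. C_nat n) \<subseteq> (\<Inter>n. C_nat n)"
  proof (intro subsetI INT_I)
    fix f n assume "f \<in> (\<Inter>n\<in>{1..}. C_nat n)"
    then show "f \<in> C_nat n" using \<open>C_nat 1 \<subseteq> C_nat 0\<close> by (cases n) auto
  qed
  then show "C_diff \<infinity> = (\<Inter>n. C_nat n)" by (auto simp: C_diff_def)
qed (simp add: C_diff_def)

lemma C_diff_antimono: "k \<le> l \<Longrightarrow> C_diff l \<subseteq> C_diff k"
  using C_nat_antimono by (cases k; cases l) (auto simp: C_diff_simps)

lemma C_diff_0: "C_diff 0 = {f. continuous_on UNIV f}"
  by (simp add: zero_enat_def C_diff_simps C_nat_0)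

lemma cring_C_ring: "cring (C_ring k)"
  by (rule cring_fun_ring; cases k)
    (auto simp: C_diff_simps C_nat_const C_nat_add C_nat_mult)

lemma cring_cont_ring: "cring cont_ring"
  using cring_C_ring[of 0] by (simp add: C_diff_0)

definition bump_aux :: "nat \<Rightarrow> real \<Rightarrow> real" where
  "bump_aux n y = (if y > 0 then exp (- 1 / y) / y ^ n else 0)"

lemma DERIV_bump_aux:
  "(bump_aux n has_field_derivative bump_aux (n + 2) y - n * bump_aux (n + 1) y) (at y)"
proof -
  consider "y > 0" | "y < 0" | "y = 0" by linarith
  then show ?thesis
  proof cases
    case 1
    have "((\<lambda>y. exp (- 1 / y) / y ^ n) has_field_derivative
        bump_aux (n + 2) y - n * bump_aux (n + 1) y) (at y)"
    proof (cases n)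
      case (Suc m)
      show ?thesis
        using 1 unfolding Suc bump_aux_def
        by (auto intro!: derivative_eq_intros simp: field_simps power2_eq_square)
          (cases m; simp)
    qed (use 1 in \<open>auto intro!: derivative_eq_intros simp: bump_aux_def field_simps power2_eq_square\<close>)
    then show ?thesis
      by (rule has_field_derivative_transform_within_open[of _ _ _ "{0<..}"])
        (use 1 in \<open>auto simp: bump_aux_def\<close>)
  next
    case 2
    have "((\<lambda>y. 0) has_field_derivative bump_aux (n + 2) y - n * bump_aux (n + 1) y) (at y)"
      using 2 by (simp add: bump_aux_def)
    then show ?thesis
      by (rule has_field_derivative_transform_within_open[of _ _ _ "{..<0}"])
        (use 2 in \<open>auto simp: bump_aux_def\<close>)
  next
    case 3
    have "((\<lambda>h::real. exp (- 1 / h) / h ^ Suc n) \<longlongrightarrow> 0) (at_right 0)"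
      by real_asymp
    then have r: "((\<lambda>h. bump_aux (Suc n) h) \<longlongrightarrow> 0) (at_right 0)"
      by (rule Lim_transform_eventually)
        (auto simp: bump_aux_def eventually_at_right_field intro: exI[of _ 1])
    have l: "((\<lambda>h. bump_aux (Suc n) h) \<longlongrightarrow> 0) (at_left 0)"
      by (rule Lim_transform_eventually[OF tendsto_const])
        (auto simp: bump_aux_def eventually_at_left_field intro: exI[of _ "-1"])
    have "((\<lambda>h. bump_aux (Suc n) h) \<longlongrightarrow> 0) (at 0)"
      using l r by (simp add: filterlim_split_at)
    moreover have "(\<lambda>h. bump_aux (Suc n) h) = (\<lambda>h. (bump_aux n (0 + h) - bump_aux n 0) / h)"
      by (auto simp: bump_aux_def)
    ultimately show ?thesis
      using 3 by (simp add: DERIV_def bump_aux_def)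
  qed
qed

lemma bump_aux_C_nat: "(\<lambda>x. bump_aux n (s * x + c)) \<in> C_nat m"
proof (induction m arbitrary: n)
  case 0
  have "continuous_on UNIV (bump_aux n)"
    using DERIV_bump_aux[of n] DERIV_isCont continuous_at_imp_continuous_on by blast
  then show ?case
    by (auto simp: C_nat_0 intro!: continuous_intros continuous_on_compose2[of UNIV "bump_aux n"])
next
  case (Suc m)
  have D: "((\<lambda>x. bump_aux n (s * x + c)) has_field_derivative
      s * (bump_aux (n + 2) (s * x + c) + (- n) * bump_aux (n + 1) (s * x + c))) (at x)" for x
    by (rule DERIV_chain2[OF DERIV_bump_aux, THEN DERIV_cong])
      (auto intro!: derivative_eq_intros)
  have "deriv (\<lambda>x. bump_aux n (s * x + c)) =
      (\<lambda>x. s * (bump_aux (n + 2) (s * x + c) + (- n) * bump_aux (n + 1) (s * x + c)))"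
    using D by (intro ext DERIV_imp_deriv)
  moreover have "\<dots> \<in> C_nat m"
    by (intro C_nat_mult C_nat_const C_nat_add Suc.IH)
  moreover have "(\<lambda>x. bump_aux n (s * x + c)) field_differentiable (at x)" for x
    using D field_differentiable_def by blast
  ultimately show ?case by (simp add: C_nat_Suc)
qed

lemma smooth_bump:
  assumes "e > 0"
  obtains b where "b \<in> C_diff \<infinity>" "\<And>x. b x \<noteq> 0 \<longleftrightarrow> x \<in> ball a e"
proof
  let ?b = "\<lambda>x. bump_aux 0 (1 * x + (e - a)) * bump_aux 0 ((- 1) * x + (a + e))"
  show "?b \<in> C_diff \<infinity>"
    unfolding C_diff_simps by (intro INT_I C_nat_mult bump_aux_C_nat)
  show "?b x \<noteq> 0 \<longleftrightarrow> x \<in> ball a e" for x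
    by (auto simp: bump_aux_def dist_real_def)
qed

lemma non_zero_divisors_fun_ring:
  assumes smooth: "C_diff \<infinity> \<subseteq> A" and cont: "A \<subseteq> {f. continuous_on UNIV f}"
  shows "non_zero_divisors (fun_ring A) = {g \<in> A. closure {x. g x \<noteq> 0} = UNIV}"
proof (intro equalityI subsetI)
  fix g assume g: "g \<in> non_zero_divisors (fun_ring A)"
  then have gA: "g \<in> A" by (simp add: non_zero_divisors_def)
  have "x \<in> closure {x. g x \<noteq> 0}" for x
  proof (rule ccontr)
    assume "x \<notin> closure {x. g x \<noteq> 0}"
    then obtain e where e: "e > 0" "ball x e \<subseteq> - closure {x. g x \<noteq> 0}"
      by (metis ComplI closed_closure open_Compl open_contains_ball)
    obtain b where b: "b \<in> C_diff \<infinity>" "\<And>y. b y \<noteq> 0 \<longleftrightarrow> y \<in> ball x e"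
      using smooth_bump[OF e(1)] by blast
    have "g y * b y = 0" for y
      using b(2)[of y] e(2) closure_subset[of "{x. g x \<noteq> 0}"] by auto
    then have "(\<lambda>y. g y * b y) = (\<lambda>y. 0)" by blast
    moreover have "b \<in> A" using b(1) smooth by blast
    moreover have "\<forall>a\<in>A. (\<lambda>x. g x * a x) = (\<lambda>x. 0) \<longrightarrow> a = (\<lambda>x. 0)"
      using g unfolding non_zero_divisors_def by simp
    ultimately have "b = (\<lambda>x. 0)" by blast
    then show False using b(2)[of x] e(1) by simp
  qed
  with gA show "g \<in> {g \<in> A. closure {x. g x \<noteq> 0} = UNIV}" by auto
next
  fix g assume g: "g \<in> {g \<in> A. closure {x. g x \<noteq> 0} = UNIV}"
  have "f = (\<lambda>x. 0)" if f: "f \<in> A" and z: "(\<lambda>x. g x * f x) = (\<lambda>x. 0)" for f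
  proof -
    have "{x. g x \<noteq> 0} \<subseteq> f -` {0}" using fun_cong[OF z] by auto
    moreover have "closed (f -` {0})"
      using f cont by (intro closed_vimage) auto
    ultimately have "closure {x. g x \<noteq> 0} \<subseteq> f -` {0}" by (rule closure_minimal)
    then show ?thesis using g by auto
  qed
  then show "g \<in> non_zero_divisors (fun_ring A)"
    using g by (auto simp: non_zero_divisors_def)
qed

lemma C_diff_between: "C_diff \<infinity> \<subseteq> C_diff k" "C_diff k \<subseteq> {f. continuous_on UNIV f}"
  using C_diff_antimono[of k \<infinity>] C_diff_antimono[of 0 k] by (auto simp: C_diff_0)

lemma non_zero_divisors_C_ring:
  "non_zero_divisors (C_ring k) = {g \<in> C_diff k. closure {x. g x \<noteq> 0} = UNIV}"
  by (rule non_zero_divisors_fun_ring) (rule C_diff_between)+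

lemma non_zero_divisors_cont_ring:
  "non_zero_divisors cont_ring = {g. continuous_on UNIV g \<and> closure {x. g x \<noteq> 0} = UNIV}"
  using non_zero_divisors_C_ring[of 0] by (simp add: C_diff_0)

lemma non_zero_divisors_mono:
  "non_zero_divisors (C_ring k) \<subseteq> non_zero_divisors cont_ring"
  using C_diff_between(2)[of k] unfolding non_zero_divisors_C_ring non_zero_divisors_cont_ring by auto

lemma mult_set_C_ring: "mult_set (C_ring k) (non_zero_divisors (C_ring k))"
  by (rule cring.mult_set_non_zero_divisors[OF cring_C_ring])

lemma mult_set_cont_ring: "mult_set cont_ring (non_zero_divisors cont_ring)"
  by (rule cring.mult_set_non_zero_divisors[OF cring_cont_ring])

lemma fraction_cont_eq_iff:
  assumes "continuous_on UNIV h" "g \<in> non_zero_divisors cont_ring"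
    "continuous_on UNIV h'" "g' \<in> non_zero_divisors cont_ring"
  shows "fraction cont_ring (non_zero_divisors cont_ring) h g =
           fraction cont_ring (non_zero_divisors cont_ring) h' g' \<longleftrightarrow>
         (\<forall>x. g' x * h x = g x * h' x)"
proof -
  have 1: "(\<lambda>x. g' x * h x) = (\<lambda>x. g x * h' x)"
    if u: "u \<in> non_zero_divisors cont_ring"
      and eq: "(\<lambda>x. u x * (g' x * h x)) = (\<lambda>x. u x * (g x * h' x))" for u
  proof -
    have "continuous_on UNIV (\<lambda>x. g' x * h x - g x * h' x)"
      using assms by (auto simp: non_zero_divisors_cont_ring intro!: continuous_intros)
    moreover have "(\<lambda>x. u x * (g' x * h x - g x * h' x)) = (\<lambda>x. 0)"
      using fun_cong[OF eq] by (intro ext) (simp add: right_diff_distrib)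
    ultimately have "(\<lambda>x. g' x * h x - g x * h' x) = (\<lambda>x. 0)"
      using u unfolding non_zero_divisors_def by simp
    then show ?thesis by (simp add: fun_eq_iff)
  qed
  have 2: "(\<lambda>x. 1) \<in> non_zero_divisors cont_ring"
    by (simp add: non_zero_divisors_cont_ring)
  have "fraction cont_ring (non_zero_divisors cont_ring) h g =
      fraction cont_ring (non_zero_divisors cont_ring) h' g' \<longleftrightarrow>
    (\<exists>u\<in>non_zero_divisors cont_ring. (\<lambda>x. u x * (g' x * h x)) = (\<lambda>x. u x * (g x * h' x)))"
    using assms mult_set.fraction_eq_iff[OF mult_set_cont_ring, of h g h' g'] by simp
  also have "\<dots> \<longleftrightarrow> (\<lambda>x. g' x * h x) = (\<lambda>x. g x * h' x)"
  proof
    assume "(\<lambda>x. g' x * h x) = (\<lambda>x. g x * h' x)"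
    then have "\<forall>x. g' x * h x = g x * h' x" by (simp add: fun_eq_iff)
    then show "\<exists>u\<in>non_zero_divisors cont_ring.
        (\<lambda>x. u x * (g' x * h x)) = (\<lambda>x. u x * (g x * h' x))"
      by (intro bexI[OF _ 2] ext) simp
  qed (use 1 in blast)
  finally show ?thesis by (simp only: fun_eq_iff)
qed

lemma Qcl_incl_fraction:
  assumes "h \<in> C_diff k" "g \<in> non_zero_divisors (C_ring k)"
  shows "Qcl_incl cont_ring (fraction (C_ring k) (non_zero_divisors (C_ring k)) h g) =
           fraction cont_ring (non_zero_divisors cont_ring) h g"
  unfolding Qcl_incl_def
proof (rule mult_set.UN_fraction[OF mult_set_C_ring])
  fix b t c r
  assume "((b, t), (c, r)) \<in> frac_rel (C_ring k) (non_zero_divisors (C_ring k))"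
  then have bc: "b \<in> C_diff k" "c \<in> C_diff k"
    and tr: "t \<in> non_zero_divisors cont_ring" "r \<in> non_zero_divisors cont_ring"
    and ex: "\<exists>u\<in>non_zero_divisors cont_ring. (\<lambda>x. u x * (r x * b x)) = (\<lambda>x. u x * (t x * c x))"
    using non_zero_divisors_mono[of k] unfolding frac_rel_def by auto
  then show "fraction cont_ring (non_zero_divisors cont_ring) b t =
      fraction cont_ring (non_zero_divisors cont_ring) c r"
    using C_diff_between(2)[of k]
    by (subst mult_set.fraction_eq_iff[OF mult_set_cont_ring]) auto
qed (use assms in auto)

lemma carrier_Qcl_C_ring:
  "carrier (Qcl (C_ring k)) = {fraction (C_ring k) (non_zero_divisors (C_ring k)) h g | h g.
     h \<in> C_diff k \<and> g \<in> non_zero_divisors (C_ring k)}"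
  unfolding Qcl_def mult_set.carrier_localization[OF mult_set_C_ring] by simp

lemma Qcl_incl_hom: "Qcl_incl cont_ring \<in> ring_hom (Qcl (C_ring k)) (Qcl cont_ring)"
proof -
  let ?N = "non_zero_divisors (C_ring k)" and ?M = "non_zero_divisors cont_ring"
  note A = mult_set_C_ring[of k] and B = mult_set_cont_ring
  note rules = mult_set.mult_fraction[OF A] mult_set.add_fraction[OF A]
    mult_set.mult_fraction[OF B] mult_set.add_fraction[OF B]
    mult_set.one_localization[OF A] mult_set.one_localization[OF B]
    mult_set.S_mult[OF A, simplified] mult_set.S_one[OF A, simplified] Qcl_incl_fraction
  have C: "(\<lambda>x. f x * g x) \<in> C_diff k" "(\<lambda>x. f x + g x) \<in> C_diff k"
    if "f \<in> C_diff k" "g \<in> C_diff k" for f g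
    using that cring_C_ring[of k] ring.ring_simprules(1,5)[of "C_ring k"]
    by (auto simp: cring_def)
  have N: "g \<in> C_diff k" "continuous_on UNIV g" "g \<in> ?M" if "g \<in> ?N" for g
    using that non_zero_divisors_mono[of k] C_diff_between(2)[of k]
    by (auto simp: non_zero_divisors_C_ring)
  have K: "continuous_on UNIV h" if "h \<in> C_diff k" for h
    using that C_diff_between(2)[of k] by auto
  have one: "(\<lambda>x. 1) \<in> C_diff k"
    using N(1) mult_set.S_one[OF A] by simp
  show ?thesis
  proof (rule ring_hom_memI)
    fix X assume "X \<in> carrier (Qcl (C_ring k))"
    then obtain h g where X: "X = fraction (C_ring k) ?N h g" "h \<in> C_diff k" "g \<in> ?N"
      unfolding carrier_Qcl_C_ring by blast
    show "Qcl_incl cont_ring X \<in> carrier (Qcl cont_ring)"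
      using X N K mult_set.fraction_in_carrier[OF B, of h g] unfolding Qcl_def
      by (simp add: Qcl_incl_fraction)
    fix Y assume "Y \<in> carrier (Qcl (C_ring k))"
    then obtain h' g' where Y: "Y = fraction (C_ring k) ?N h' g'" "h' \<in> C_diff k" "g' \<in> ?N"
      unfolding carrier_Qcl_C_ring by blast
    show "Qcl_incl cont_ring (X \<otimes>\<^bsub>Qcl (C_ring k)\<^esub> Y) =
        Qcl_incl cont_ring X \<otimes>\<^bsub>Qcl cont_ring\<^esub> Qcl_incl cont_ring Y"
      using X Y N K C unfolding Qcl_def by (simp add: rules)
    show "Qcl_incl cont_ring (X \<oplus>\<^bsub>Qcl (C_ring k)\<^esub> Y) =
        Qcl_incl cont_ring X \<oplus>\<^bsub>Qcl cont_ring\<^esub> Qcl_incl cont_ring Y"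
      using X Y N K C unfolding Qcl_def by (simp add: rules)
  next
    show "Qcl_incl cont_ring \<one>\<^bsub>Qcl (C_ring k)\<^esub> = \<one>\<^bsub>Qcl cont_ring\<^esub>"
      using one unfolding Qcl_def by (simp add: rules)
  qed
qed

lemma Qcl_incl_inj: "inj_on (Qcl_incl cont_ring) (carrier (Qcl (C_ring k)))"
proof (rule inj_onI)
  let ?N = "non_zero_divisors (C_ring k)"
  have N: "g \<in> C_diff k" "g \<in> non_zero_divisors cont_ring" if "g \<in> ?N" for g
    using that non_zero_divisors_mono[of k] by (auto simp: non_zero_divisors_C_ring)
  fix X Y assume "X \<in> carrier (Qcl (C_ring k))" "Y \<in> carrier (Qcl (C_ring k))"
    and eq: "Qcl_incl cont_ring X = Qcl_incl cont_ring Y"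
  then obtain h g h' g' where
    X: "X = fraction (C_ring k) ?N h g" "h \<in> C_diff k" "g \<in> ?N" and
    Y: "Y = fraction (C_ring k) ?N h' g'" "h' \<in> C_diff k" "g' \<in> ?N"
    unfolding carrier_Qcl_C_ring by blast
  have "\<forall>x. g' x * h x = g x * h' x"
    using eq X Y N C_diff_between(2)[of k]
    by (subst fraction_cont_eq_iff[symmetric]) (auto simp: Qcl_incl_fraction)
  then show "X = Y"
    unfolding X(1) Y(1) using X Y
    by (intro mult_set.fraction_eqI[OF mult_set_C_ring]) auto
qed

end

(* By the quotient rule, g f = h with f in C^k and g, h in C^(k+1) forces the k-th derivative of f
   to be differentiable wherever g does not vanish, which is a dense open set.  So no fraction over
   C^(k+1) equals a k-fold antiderivative f of a continuous function that fails to be differentiable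
   at every rational, such as the sum of the functions (|x - q| - |q|) / 2^n over an
   enumeration q of the rationals. *)
theory Submission
  imports Defs
begin

text \<open>The quotient is the forward difference quotient at \<open>a\<close> minus the backward
  one, and both tend to the derivative. This detects a kink even inside an infinite sum, because
  second differences add termwise.\<close>

lemma differentiable_imp_second_difference_tendsto_0:
  fixes f :: "real \<Rightarrow> real"
  assumes "f field_differentiable (at a)"
  shows "((\<lambda>h. (f (a + h) + f (a - h) - 2 * f a) / h) \<longlongrightarrow> 0) (at_right 0)"
proof -
  obtain D where "(f has_field_derivative D) (at a)"
    using assms field_differentiable_def by blast
  then have D: "((\<lambda>h. (f (a + h) - f a) / h) \<longlongrightarrow> D) (at 0)"
    by (simp add: DERIV_def)
  then have "((\<lambda>h. (f (a + (- h)) - f a) / (- h)) \<longlongrightarrow> D) (at_right 0)"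
    by (rule filterlim_compose)
      (auto simp: filterlim_at eventually_at_filter intro!: tendsto_eq_intros)
  moreover have "((\<lambda>h. (f (a + h) - f a) / h) \<longlongrightarrow> D) (at_right 0)"
    using D by (rule tendsto_within_subset) simp
  ultimately have "((\<lambda>h. (f (a + h) - f a) / h - (f (a + (- h)) - f a) / (- h)) \<longlongrightarrow> D - D) (at_right 0)"
    by (intro tendsto_diff)
  moreover have "(f (a + h) - f a) / h - (f (a + (- h)) - f a) / (- h)
      = (f (a + h) + f (a - h) - 2 * f a) / h" for h
    by (simp add: diff_divide_distrib add_divide_distrib)
  ultimately show ?thesis by simp
qed

text \<open>Every summand is convex, so its second differences are nonnegative and no other summand
  can cancel the kink of the \<open>m\<close>-th one at \<open>q m\<close>.\<close>

lemma ex_continuous_not_differentiable_on_Rats: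
  obtains f :: "real \<Rightarrow> real" where "continuous_on UNIV f"
    "\<And>a. a \<in> \<rat> \<Longrightarrow> \<not> f field_differentiable (at a)"
proof
  define q :: "nat \<Rightarrow> real" where "q = from_nat_into \<rat>"
  have range_q: "range q = \<rat>"
    unfolding q_def by (rule range_from_nat_into) (auto simp: countable_rat)
  \<comment> \<open>Subtracting \<open>\<bar>q n\<bar>\<close> bounds the second factor by
    \<open>\<bar>x\<bar>\<close> for every \<open>n\<close>, so the series converges although the
    points \<open>q n\<close> are unbounded.\<close>
  define t where "t n x = (1/2)^n * (\<bar>x - q n\<bar> - \<bar>q n\<bar>)" for n and x :: real
  define f where "f x = (\<Sum>n. t n x)" for x
  have geo: "summable (\<lambda>n. (1/2 :: real)^n * C)" for C
    by (intro summable_mult2 summable_geometric) simp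
  have summ: "summable (\<lambda>n. t n x)" for x
  proof (rule summable_comparison_test'[OF geo[of "\<bar>x\<bar>"]])
    show "norm (t n x) \<le> (1/2)^n * \<bar>x\<bar>" for n
      by (auto simp: t_def abs_mult)
  qed
  \<comment> \<open>The second factor of \<open>t n\<close> is 1-Lipschitz and the weights
    \<open>(1/2)^n\<close> sum to 2, so \<open>f\<close> is 2-Lipschitz.\<close>
  have le: "f x \<le> f y + 2 * \<bar>x - y\<bar>" for x y
  proof -
    have "f x \<le> (\<Sum>n. t n y + (1/2)^n * \<bar>x - y\<bar>)"
      unfolding f_def
    proof (rule suminf_le)
      fix n
      have "(1/2)^n * (\<bar>x - q n\<bar> - \<bar>q n\<bar>) \<le> (1/2)^n * ((\<bar>y - q n\<bar> - \<bar>q n\<bar>) + \<bar>x - y\<bar>)"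
        by (intro mult_left_mono) auto
      then show "t n x \<le> t n y + (1/2)^n * \<bar>x - y\<bar>"
        unfolding t_def distrib_left .
    qed (intro summ summable_add geo)+
    also have "\<dots> = f y + (\<Sum>n. (1/2)^n * \<bar>x - y\<bar>)"
      unfolding f_def by (intro suminf_add[symmetric] summ geo)
    also have "(\<Sum>n. (1/2 :: real)^n * \<bar>x - y\<bar>) = 2 * \<bar>x - y\<bar>"
      by (subst suminf_mult2[symmetric]) (auto intro: summable_geometric simp: suminf_geometric)
    finally show ?thesis .
  qed
  have "2-lipschitz_on UNIV f"
  proof (rule lipschitz_onI)
    show "dist (f x) (f y) \<le> 2 * dist x y" for x y
      using le[of x y] le[of y x] by (auto simp: dist_real_def abs_minus_commute)
  qed simp
  then show "continuous_on UNIV f" by (rule lipschitz_on_continuous_on)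
  fix a :: real assume "a \<in> \<rat>"
  then obtain m where m: "a = q m" using range_q by auto
  \<comment> \<open>The second difference of \<open>f\<close> is at least that of the single term
    \<open>m\<close>, which at its kink is \<open>2 * (1/2)^m * h\<close>. The lower bound for the
    quotient is therefore independent of \<open>h\<close>.\<close>
  have low: "2 * (1/2)^m \<le> (f (a + h) + f (a - h) - 2 * f a) / h" if "h > 0" for h
  proof -
    let ?s = "\<lambda>n. t n (a + h) + t n (a - h) - 2 * t n a"
    have s: "?s n = (1/2)^n * (\<bar>a + h - q n\<bar> + \<bar>a - h - q n\<bar> - 2 * \<bar>a - q n\<bar>)" for n
      unfolding t_def by (simp add: algebra_simps)
    have nonneg: "?s n \<ge> 0" for n
    proof -
      have "2 * \<bar>a - q n\<bar> \<le> \<bar>a + h - q n\<bar> + \<bar>a - h - q n\<bar>"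
        using abs_triangle_ineq[of "a + h - q n" "a - h - q n"] abs_mult[of 2 "a - q n"]
        by (simp add: algebra_simps)
      then show ?thesis unfolding s by simp
    qed
    have sums: "?s sums (f (a + h) + f (a - h) - 2 * f a)"
      unfolding f_def by (intro sums_diff sums_add sums_mult summable_sums summ)
    have "2 * (1/2)^m * h = sum ?s {m}"
      unfolding s using that by (simp add: m)
    also have "\<dots> \<le> suminf ?s"
      using nonneg sums_summable[OF sums] by (intro sum_le_suminf) auto
    also have "suminf ?s = f (a + h) + f (a - h) - 2 * f a"
      using sums by (rule sums_unique[symmetric])
    finally show ?thesis
      using that by (simp add: pos_le_divide_eq)
  qed
  show "\<not> f field_differentiable (at a)"
  proof
    assume "f field_differentiable (at a)"
    then have "((\<lambda>h. (f (a + h) + f (a - h) - 2 * f a) / h) \<longlongrightarrow> 0) (at_right 0)"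
      by (rule differentiable_imp_second_difference_tendsto_0)
    then have "2 * (1/2)^m \<le> (0 :: real)"
      by (rule tendsto_lowerbound)
        (auto simp: eventually_at_right_field intro!: exI[of _ 1] low)
    moreover have "0 < (1/2 :: real)^m" by simp
    ultimately show False by linarith
  qed
qed

lemma ex_C_nat_iterated_antiderivative:
  assumes "continuous_on UNIV f"
  shows "\<exists>F\<in>C_nat n. (deriv ^^ n) F = f"
proof (induction n)
  case 0
  then show ?case using assms by (simp add: C_nat_0)
next
  case (Suc n)
  then obtain F where F: "F \<in> C_nat n" "(deriv ^^ n) F = f" by blast
  then have "continuous_on UNIV F"
    using C_nat_antimono[of 0 n] by (auto simp: C_nat_0)
  then have "isCont F x" for x by (simp add: continuous_on_eq_continuous_at)
  then obtain G where "\<And>x. (G has_vector_derivative F x) (at x)"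
    using einterval_antiderivative[of "-\<infinity>" \<infinity> F] by auto
  then have G: "(G has_field_derivative F x) (at x)" for x
    by (simp add: has_real_derivative_iff_has_vector_derivative)
  then have dG: "deriv G = F" by (intro ext DERIV_imp_deriv)
  have "G field_differentiable (at x)" for x
    using G field_differentiable_def by blast
  then have "G \<in> C_nat (Suc n)"
    using F(1) by (simp add: C_nat_Suc dG)
  moreover have "(deriv ^^ Suc n) G = f"
    using F(2) dG by (simp add: funpow_swap1)
  ultimately show ?case by blast
qed

text \<open>Induction on \<open>n\<close> by a quotient rule without division: from
  \<open>g f = h\<close> follows \<open>g^2 f' = g h' - g' h\<close>, a relation of the same shape
  for \<open>f'\<close>, and \<open>g^2\<close> vanishes only where \<open>g\<close> does.\<close>

lemma differentiable_deriv_of_C_nat_multiple: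
  assumes "f \<in> C_nat n" "g \<in> C_nat (Suc n)" "h \<in> C_nat (Suc n)"
    and "\<And>x. g x * f x = h x" and "g a \<noteq> 0"
  shows "(deriv ^^ n) f field_differentiable (at a)"
  using assms
proof (induction n arbitrary: f g h)
  case 0
  then have d: "g field_differentiable (at a)" "h field_differentiable (at a)"
    by (simp_all add: C_nat_Suc)
  have "continuous_on UNIV g"
    using 0 by (intro field_differentiable_imp_continuous_on) (simp add: C_nat_Suc)
  then have "open {x. g x \<noteq> 0}"
    by (intro open_Collect_neq continuous_intros)
  \<comment> \<open>Near \<open>a\<close> the function \<open>f\<close> coincides with
    \<open>h / g\<close>, so it inherits the derivative of this quotient.\<close>
  moreover obtain D where "((\<lambda>x. h x / g x) has_field_derivative D) (at a)"
    using d 0(5) field_differentiable_divide field_differentiable_def by blast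
  moreover have "h x / g x = f x" if "g x \<noteq> 0" for x
    using that 0(4)[of x] by (simp add: field_simps)
  ultimately have "(f has_field_derivative D) (at a)"
    using 0(5) by (elim has_field_derivative_transform_within_open) auto
  then show ?case
    unfolding field_differentiable_def by auto
next
  case (Suc n)
  have d: "f field_differentiable (at x)" "g field_differentiable (at x)"
    "h field_differentiable (at x)" for x
    using Suc.prems by (simp_all add: C_nat_Suc)
  have der: "g x * deriv f x + deriv g x * f x = deriv h x" for x
  proof -
    have "h = (\<lambda>x. g x * f x)" using Suc.prems(4) by auto
    then show ?thesis using d by simp
  qed
  \<comment> \<open>Differentiating \<open>g\<close> and \<open>h\<close> costs one order, which is
    exactly the drop from \<open>Suc (Suc n)\<close> to the \<open>Suc n\<close> that the induction
    hypothesis asks for.\<close>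
  have C: "g \<in> C_nat (Suc n)" "h \<in> C_nat (Suc n)"
    "deriv g \<in> C_nat (Suc n)" "deriv h \<in> C_nat (Suc n)"
    using Suc.prems(2,3) C_nat_antimono[of "Suc n" "Suc (Suc n)"]
    by (auto simp only: C_nat_Suc[of _ "Suc n"] le_Suc_eq subset_iff)
  have "(deriv ^^ n) (deriv f) field_differentiable (at a)"
  proof (rule Suc.IH)
    show "deriv f \<in> C_nat n" using Suc.prems(1) by (simp add: C_nat_Suc)
    show "(\<lambda>x. g x * g x) \<in> C_nat (Suc n)" using C by (intro C_nat_mult)
    show "(\<lambda>x. g x * deriv h x + (- 1) * (deriv g x * h x)) \<in> C_nat (Suc n)"
      using C by (intro C_nat_add C_nat_mult C_nat_const)
    \<comment> \<open>This is \<open>der\<close> multiplied by \<open>g x\<close>, with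
      \<open>g x * f x\<close> replaced by \<open>h x\<close>.\<close>
    show "g x * g x * deriv f x = g x * deriv h x + (- 1) * (deriv g x * h x)" for x
      unfolding der[symmetric] Suc.prems(4)[symmetric] by (simp add: algebra_simps)
    show "g a * g a \<noteq> 0" using Suc.prems(5) by simp
  qed
  then show ?case by (simp add: funpow_swap1)
qed

text \<open>For all \<open>k\<close> the fractions are now classes over the one ring
  \<open>cont_ring\<close>, so the sets for different \<open>k\<close> can be compared
  directly.\<close>

lemma Qcl_C_eq:
  "Qcl_C k = {fraction cont_ring (non_zero_divisors cont_ring) h g | h g.
     h \<in> C_diff k \<and> g \<in> C_diff k \<and> closure {x. g x \<noteq> 0} = UNIV}"
proof -
  have "Qcl_C k = {Qcl_incl cont_ring (fraction (C_ring k) (non_zero_divisors (C_ring k)) h g) | h g.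
      h \<in> C_diff k \<and> g \<in> non_zero_divisors (C_ring k)}"
    unfolding Qcl_C_def carrier_Qcl_C_ring by blast
  also have "\<dots> = {fraction cont_ring (non_zero_divisors cont_ring) h g | h g.
      h \<in> C_diff k \<and> g \<in> non_zero_divisors (C_ring k)}"
    by (rule Collect_cong) (metis Qcl_incl_fraction)
  finally show ?thesis
    unfolding non_zero_divisors_C_ring by simp
qed

lemma Qcl_C_antimono: "k \<le> l \<Longrightarrow> Qcl_C l \<subseteq> Qcl_C k"
  using C_diff_antimono[of k l] unfolding Qcl_C_eq by blast

lemma ex_mem_Qcl_C_not_mem_Suc: "\<exists>X. X \<in> Qcl_C (enat n) \<and> X \<notin> Qcl_C (enat (Suc n))"
proof -
  let ?M = "non_zero_divisors cont_ring"
  obtain \<phi> :: "real \<Rightarrow> real" where \<phi>: "continuous_on UNIV \<phi>"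
    "\<And>a. a \<in> \<rat> \<Longrightarrow> \<not> \<phi> field_differentiable (at a)"
    using ex_continuous_not_differentiable_on_Rats by blast
  obtain f where f: "f \<in> C_nat n" "(deriv ^^ n) f = \<phi>"
    using ex_C_nat_iterated_antiderivative[OF \<phi>(1)] by blast
  have "fraction cont_ring ?M f (\<lambda>x. 1) \<in> Qcl_C (enat n)"
    using f(1) C_nat_const[of 1 n] unfolding Qcl_C_eq C_diff_simps
    by (intro CollectI exI[of _ f] exI[of _ "\<lambda>x. 1"]) auto
  moreover have "fraction cont_ring ?M f (\<lambda>x. 1) \<notin> Qcl_C (enat (Suc n))"
  proof
    assume "fraction cont_ring ?M f (\<lambda>x. 1) \<in> Qcl_C (enat (Suc n))"
    then obtain h g where hg: "h \<in> C_nat (Suc n)" "g \<in> C_nat (Suc n)"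
      "closure {x. g x \<noteq> 0} = UNIV" "fraction cont_ring ?M f (\<lambda>x. 1) = fraction cont_ring ?M h g"
      unfolding Qcl_C_eq C_diff_simps by blast
    have cont: "continuous_on UNIV f" "continuous_on UNIV h" "continuous_on UNIV g"
      using f(1) hg C_nat_antimono[of 0 n] C_nat_antimono[of 0 "Suc n"] by (auto simp: C_nat_0)
    \<comment> \<open>Over continuous functions, equality with a fraction of denominator 1 is a
      pointwise identity on the whole line, also at the zeros of \<open>g\<close>.\<close>
    have eq: "g x * f x = h x" for x
      using hg cont fraction_cont_eq_iff[of f "\<lambda>x. 1" h g]
      by (simp add: non_zero_divisors_cont_ring)
    have "open {x. g x \<noteq> 0}"
      using cont by (intro open_Collect_neq continuous_intros)
    \<comment> \<open>A dense set is nonempty, and being open it then contains a rational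
      \<open>a\<close>, where \<phi> has no derivative.\<close>
    moreover obtain b where "g b \<noteq> 0" using hg(3) by fastforce
    ultimately obtain e where e: "e > 0" "ball b e \<subseteq> {x. g x \<noteq> 0}"
      unfolding open_contains_ball by blast
    obtain a where a: "a \<in> \<rat>" "b < a" "a < b + e"
      using Rats_dense_in_real[of b "b + e"] e(1) by auto
    then have "a \<in> ball b e" by (simp add: dist_real_def)
    then have "g a \<noteq> 0" using e(2) by blast
    then show False
      using differentiable_deriv_of_C_nat_multiple[OF f(1) hg(2,1) eq] f(2) \<phi>(2) a(1) by blast
  qed
  ultimately show ?thesis by blast
qed

theorem proposition3p5:
  fixes k l :: enat
  assumes "1 \<le> k" and "k < l"
  shows "Qcl_C k \<noteq> Qcl_C l \<and> Qcl_C l \<subset> Qcl_C k"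
proof -
  \<comment> \<open>Being below \<open>l\<close>, \<open>k\<close> is finite. The fraction that
    separates \<open>n\<close> from \<open>Suc n\<close> then also separates \<open>k\<close> from
    \<open>l\<close>, including \<open>l = \<infinity>\<close>.\<close>
  obtain n where n: "k = enat n" using assms(2) by (cases k) auto
  then have "enat (Suc n) \<le> l" using assms(2) by (simp add: Suc_ile_eq)
  then have "Qcl_C l \<subseteq> Qcl_C (enat (Suc n))" by (rule Qcl_C_antimono)
  moreover have "Qcl_C l \<subseteq> Qcl_C k" using assms(2) by (intro Qcl_C_antimono) simp
  ultimately show ?thesis
    using ex_mem_Qcl_C_not_mem_Suc[of n] n by blast
qed

end
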